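(* Let $a\in\mathbb{R}$, $b\in[0,1]$, let $N$ be a positive integer written as $N=2M+1$ or $N=2M$ with $M$ an integer, and let $f:K^+_{[a,a+1]}\to\mathbb{C}$ be a function. Then there exists a unique symmetric interpolating polynomial for $f$, that is, a unique function of the form $$\psi^+_N(x,y)=\sum_{\substack{k,l=-M\\ k\ge l}}^{M} c^+_{kl}\,E^+_{(k,l)}(x,y),\qquad x,y\in\mathbb{R},$$ with coefficients $c^+_{kl}\in\mathbb{C}$ which, in the case $N=2M$, are assumed to satisfy the additional $2M+1$ conditions $$c^+_{l,-M}=\tau_N\,c^+_{M,l}\quad (l=-M,\dots,M),$$ such that $$\psi^+_N(x_m,y_n)=f(x_m,y_n)\quad\text{for all } m,n\in\{0,\dots,N-1\},\ m\ge n.$$ Its coefficients ($k,l\in\{-M,\dots,M\}$, $k\ge l$) are given for $N=2M+1$ by $$c^+_{kl}=\frac{1}{G_{kl}N^2}\sum_{\substack{m,n=0\\ m\ge n}}^{N-1}G_{mn}^{-1}f(x_m,y_n)\,\overline{E^+_{(k,l)}(x_m,y_n)},$$ and for $N=2M$, assuming the additional conditions above, by $$c^+_{kl}=\frac{g_{k,M}\,g_{l,M}}{G_{kl}N^2}\sum_{\substack{m,n=0\\ m\ge n}}^{N-1}G_{mn}^{-1}f(x_m,y_n)\,\overline{E^+_{(k,l)}(x_m,y_n)}.$$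
   Context: For $k,l\in\mathbb{Z}$ and $x,y\in\mathbb{R}$, the symmetric exponential function is $E^+_{(k,l)}(x,y)=e^{2\pi i(kx+ly)}+e^{2\pi i(ky+lx)}$. The triangle is $K^+_{[a,a+1]}=\{(x,y)\in[a,a+1]\times[a,a+1] : x\ge y\}$. The grid points are $(x_m,y_n)=\left(a+\frac{m+b}{N},\,a+\frac{n+b}{N}\right)$ for $m,n\in\{0,\dots,N-1\}$. Put $\tau_N=e^{2\pi i(Na+b)}$; $G_{kl}=2$ if $k=l$ and $G_{kl}=1$ otherwise (for any integers $k,l$); $g_{k,M}=\tfrac12$ if $k=-M$ or $k=M$, and $g_{k,M}=1$ otherwise.
   Formalization: For N=2M the printed coefficient formula contradicts the printed conditions; here, under those conditions, the factor at (M,M), (M,-M), (-M,-M) is 1/(6N^2). The printed formula is also proved under the conditions G_{l,-M}c_{l,-M}=τ_N G_{M,l}c_{M,l}. *)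

theory Defs
  imports "HOL-Analysis.Analysis"
begin

definition sym_exp :: "int \<Rightarrow> int \<Rightarrow> real \<Rightarrow> real \<Rightarrow> complex" where
  "sym_exp k l x y =
     exp (2 * of_real pi * \<i> * of_real (of_int k * x + of_int l * y))
   + exp (2 * of_real pi * \<i> * of_real (of_int k * y + of_int l * x))"

definition sym_triangle :: "real \<Rightarrow> (real \<times> real) set" where
  "sym_triangle a = {(x, y). x \<in> {a..a+1} \<and> y \<in> {a..a+1} \<and> y \<le> x}"

definition grid_pt :: "real \<Rightarrow> real \<Rightarrow> nat \<Rightarrow> nat \<Rightarrow> real" where
  "grid_pt a b N m = a + (real m + b) / real N"

definition tau :: "real \<Rightarrow> real \<Rightarrow> nat \<Rightarrow> complex" where
  "tau a b N = exp (2 * of_real pi * \<i> * of_real (real N * a + b))"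

definition Gw :: "int \<Rightarrow> int \<Rightarrow> complex" where
  "Gw k l = (if k = l then 2 else 1)"

definition gw :: "int \<Rightarrow> int \<Rightarrow> complex" where
  "gw k M = (if k = - M \<or> k = M then 1 / 2 else 1)"

definition freq_pairs :: "int \<Rightarrow> (int \<times> int) set" where
  "freq_pairs M = {(k, l). k \<in> {-M..M} \<and> l \<in> {-M..M} \<and> l \<le> k}"

definition grid_pairs :: "nat \<Rightarrow> (nat \<times> nat) set" where
  "grid_pairs N = {(m, n). m < N \<and> n < N \<and> n \<le> m}"

lemma finite_freq_pairs: "finite (freq_pairs M)"
  by (rule finite_subset [of _ "{-M..M} \<times> {-M..M}"]) (auto simp: freq_pairs_def)

lemma finite_grid_pairs: "finite (grid_pairs N)"
  by (rule finite_subset [of _ "{..<N} \<times> {..<N}"]) (auto simp: grid_pairs_def)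

lemma grid_pairs_in_sym_triangle:
  assumes "b \<in> {0..1}" "(m, n) \<in> grid_pairs N"
  shows "(grid_pt a b N m, grid_pt a b N n) \<in> sym_triangle a"
proof -
  have "real m + b \<le> real N" "real n + b \<le> real N" "real n \<le> real m" "real N > 0"
    using assms by (auto simp: grid_pairs_def)
  then show ?thesis
    using assms(1) by (auto simp: sym_triangle_def grid_pt_def divide_right_mono)
qed

text \<open>Only the values of the coefficient family \<open>c\<close> on \<^term>\<open>freq_pairs M\<close> matter.\<close>

definition sym_poly :: "int \<Rightarrow> (int \<Rightarrow> int \<Rightarrow> complex) \<Rightarrow> real \<Rightarrow> real \<Rightarrow> complex" where
  "sym_poly M c x y = (\<Sum>(k, l)\<in>freq_pairs M. c k l * sym_exp k l x y)"

definition interpolates ::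
    "real \<Rightarrow> real \<Rightarrow> nat \<Rightarrow> (real \<times> real \<Rightarrow> complex) \<Rightarrow> (real \<Rightarrow> real \<Rightarrow> complex) \<Rightarrow> bool" where
  "interpolates a b N f \<psi> \<longleftrightarrow>
     (\<forall>(m, n)\<in>grid_pairs N.
        \<psi> (grid_pt a b N m) (grid_pt a b N n) = f (grid_pt a b N m, grid_pt a b N n))"

definition grid_transform ::
    "real \<Rightarrow> real \<Rightarrow> nat \<Rightarrow> (real \<times> real \<Rightarrow> complex) \<Rightarrow> int \<Rightarrow> int \<Rightarrow> complex" where
  "grid_transform a b N f k l =
     (\<Sum>(m, n)\<in>grid_pairs N.
        inverse (Gw (int m) (int n)) * f (grid_pt a b N m, grid_pt a b N n)
        * cnj (sym_exp k l (grid_pt a b N m) (grid_pt a b N n)))"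

definition boundary_conds :: "real \<Rightarrow> real \<Rightarrow> nat \<Rightarrow> int \<Rightarrow> (int \<Rightarrow> int \<Rightarrow> complex) \<Rightarrow> bool" where
  "boundary_conds a b N M c \<longleftrightarrow> (\<forall>l\<in>{-M..M}. c l (-M) = tau a b N * c M l)"

text \<open>
  For \<open>\<bar>l\<bar> < M\<close> the following conditions coincide with \<^const>\<open>boundary_conds\<close>; for \<open>l = -M\<close> and
  \<open>l = M\<close> they differ from it by a factor 2. On the grid with \<open>N = 2M\<close>, \<open>sym_exp M l\<close> is
  \<open>tau\<close> times \<open>sym_exp l (-M)\<close>, so the coefficients
  \<open>gw k M * gw l M / (Gw k l * N^2) * grid_transform a b N f k l\<close> always satisfy the weighted
  conditions. They satisfy the unweighted ones only if \<open>grid_transform a b N f M M = 0\<close>, because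
  \<open>Gw M (-M) = 1\<close> but \<open>Gw M M = Gw (-M) (-M) = 2\<close>.

  Under either set of conditions the interpolation problem is uniquely solvable. The unweighted
  ones make the pairs \<open>(M, M)\<close>, \<open>(M, -M)\<close>, \<open>(-M, -M)\<close> contribute equally on the grid, so each of
  these three coefficients is \<open>1 / (6 * N^2)\<close> times the transform; under the weighted ones the
  factors are \<open>1/8\<close>, \<open>1/4\<close>, \<open>1/8\<close> (over \<open>N^2\<close>). All other coefficients agree.
\<close>

definition weighted_boundary_conds ::
    "real \<Rightarrow> real \<Rightarrow> nat \<Rightarrow> int \<Rightarrow> (int \<Rightarrow> int \<Rightarrow> complex) \<Rightarrow> bool" where
  "weighted_boundary_conds a b N M c \<longleftrightarrow>
     (\<forall>l\<in>{-M..M}. Gw l (-M) * c l (-M) = tau a b N * (Gw M l * c M l))"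

end

theory Submission
  imports Defs
begin

text \<open>
  On the grid the exponentials with frequencies in a complete residue system modulo \<open>N\<close> are
  orthogonal, and so are the rows of the transposed matrix. Symmetrising a sum over a square into
  a sum over a triangle turns each of these relations into the corresponding relation for the
  symmetric exponentials. The first gives the coefficients of an interpolating polynomial; the
  dual one shows that these coefficients do interpolate.

  For \<open>N = 2M\<close> the frequencies \<open>-M\<close> and \<open>M\<close> agree modulo \<open>N\<close>, so on the grid each term \<open>(l, -M)\<close> is
  a multiple of \<open>(M, l)\<close>. Folding these terms onto the residues \<open>-M+1, \<dots>, M\<close> multiplies, under the
  additional conditions, \<open>c\<^sub>M\<^sub>l\<close> by 2 for \<open>\<bar>l\<bar> < M\<close> and \<open>c\<^sub>M\<^sub>M\<close> by 3, or by 4 under the weighted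
  conditions.
\<close>

section \<open>Orthogonality on triangles\<close>

text \<open>Generic in the order, as is \<open>diag_weight\<close> below, so that the same lemmas
  serve integer frequencies and natural grid indices.\<close>

definition lower_triangle :: "'a::linorder set \<Rightarrow> ('a \<times> 'a) set" where
  "lower_triangle A = {(k, l). k \<in> A \<and> l \<in> A \<and> l \<le> k}"

lemma mem_lower_triangle: "(k, l) \<in> lower_triangle A \<longleftrightarrow> k \<in> A \<and> l \<in> A \<and> l \<le> k"
  by (simp add: lower_triangle_def)

lemma finite_lower_triangle [simp]: "finite A \<Longrightarrow> finite (lower_triangle A)"
  by (rule finite_subset [of _ "A \<times> A"]) (auto simp: lower_triangle_def)

definition diag_weight :: "'a \<Rightarrow> 'a \<Rightarrow> complex" where
  "diag_weight k l = (if k = l then 2 else 1)"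

lemma diag_weight_nonzero [simp]: "diag_weight k l \<noteq> 0"
  by (simp add: diag_weight_def)

text \<open>By symmetry the square counts every off-diagonal pair of the triangle twice and every
  diagonal pair once; the weight 2 on the diagonal corrects for this.\<close>

lemma sum_lower_triangle:
  fixes h :: "'a::linorder \<Rightarrow> 'a \<Rightarrow> complex"
  assumes "finite A" and sym: "\<And>k l. h k l = h l k"
  shows "2 * (\<Sum>(k, l)\<in>lower_triangle A. inverse (diag_weight k l) * h k l) = (\<Sum>k\<in>A. \<Sum>l\<in>A. h k l)"
proof -
  let ?U = "{(k, l). k \<in> A \<and> l \<in> A \<and> l < k}"
  let ?L = "{(k, l). k \<in> A \<and> l \<in> A \<and> k < l}"
  have sub: "?U \<subseteq> lower_triangle A"
    by (auto simp: mem_lower_triangle)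
  have finL: "finite ?L"
    by (rule finite_subset [of _ "A \<times> A"]) (use assms in auto)
  have "(\<Sum>k\<in>A. \<Sum>l\<in>A. h k l) = (\<Sum>(k, l)\<in>A \<times> A. h k l)"
    by (simp add: sum.cartesian_product)
  also have "A \<times> A = lower_triangle A \<union> ?L"
    by (auto simp: mem_lower_triangle)
  also have "(\<Sum>(k, l)\<in>lower_triangle A \<union> ?L. h k l)
      = (\<Sum>(k, l)\<in>lower_triangle A. h k l) + (\<Sum>(k, l)\<in>?L. h k l)"
    by (rule sum.union_disjoint) (use assms finL in \<open>auto simp: mem_lower_triangle\<close>)
  also have "(\<Sum>(k, l)\<in>?L. h k l) = (\<Sum>(k, l)\<in>?U. h k l)"
    by (rule sum.reindex_bij_witness [of _ prod.swap prod.swap]) (auto simp: sym)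
  also have "\<dots> = (\<Sum>(k, l)\<in>lower_triangle A. if k = l then 0 else h k l)"
    by (rule sum.mono_neutral_cong_left) (use assms sub in \<open>auto simp: mem_lower_triangle split: if_splits\<close>)
  also have "(\<Sum>(k, l)\<in>lower_triangle A. h k l) + \<dots>
      = 2 * (\<Sum>(k, l)\<in>lower_triangle A. inverse (diag_weight k l) * h k l)"
    unfolding sum_distrib_left sum.distrib [symmetric]
    by (rule sum.cong) (auto simp: diag_weight_def)
  finally show ?thesis ..
qed

text \<open>The permanent of the 2 by 2 block of \<phi> with rows k, l and columns m, n. Hence it is
  symmetric in both pairs and compatible with transposition.\<close>

definition sym_prod :: "('a \<Rightarrow> 'b \<Rightarrow> complex) \<Rightarrow> 'a \<Rightarrow> 'a \<Rightarrow> 'b \<Rightarrow> 'b \<Rightarrow> complex" where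
  "sym_prod \<phi> k l m n = \<phi> k m * \<phi> l n + \<phi> k n * \<phi> l m"

lemma sym_prod_transpose: "sym_prod (\<lambda>m k. \<phi> k m) m n k l = sym_prod \<phi> k l m n"
  by (simp add: sym_prod_def mult.commute)

text \<open>The sum over the full square splits into products of one-dimensional sums. As l \<le> k
  and l' \<le> k', the crossed product \<open>S k l' * S l k'\<close> survives only if all four
  indices coincide; this produces the diagonal weight 2.\<close>

lemma sym_prod_orthogonal:
  fixes \<phi> :: "'a::linorder \<Rightarrow> 'b::linorder \<Rightarrow> complex"
  assumes "finite B"
    and orth: "\<And>k k'. k \<in> A \<Longrightarrow> k' \<in> A \<Longrightarrow>
      (\<Sum>m\<in>B. \<phi> k m * cnj (\<phi> k' m)) = (if k = k' then N else 0)"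
    and kl: "(k, l) \<in> lower_triangle A" "(k', l') \<in> lower_triangle A"
  shows "(\<Sum>(m, n)\<in>lower_triangle B.
      inverse (diag_weight m n) * (sym_prod \<phi> k l m n * cnj (sym_prod \<phi> k' l' m n)))
    = (if (k, l) = (k', l') then diag_weight k l * N ^ 2 else 0)"
proof -
  define h where "h m n = sym_prod \<phi> k l m n * cnj (sym_prod \<phi> k' l' m n)" for m n
  define S where "S x y = (\<Sum>m\<in>B. \<phi> x m * cnj (\<phi> y m))" for x y
  have S: "S x y = (if x = y then N else 0)" if "x \<in> {k, l}" "y \<in> {k', l'}" for x y
    unfolding S_def by (rule orth) (use that kl in \<open>auto simp: mem_lower_triangle\<close>)
  have "2 * (\<Sum>(m, n)\<in>lower_triangle B. inverse (diag_weight m n) * h m n) = (\<Sum>m\<in>B. \<Sum>n\<in>B. h m n)"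
    by (rule sum_lower_triangle) (use assms in \<open>auto simp: h_def sym_prod_def mult_ac add_ac\<close>)
  also have "\<dots> = (\<Sum>m\<in>B. \<Sum>n\<in>B.
      (\<phi> k m * cnj (\<phi> k' m)) * (\<phi> l n * cnj (\<phi> l' n))
    + (\<phi> k m * cnj (\<phi> l' m)) * (\<phi> l n * cnj (\<phi> k' n))
    + (\<phi> l m * cnj (\<phi> k' m)) * (\<phi> k n * cnj (\<phi> l' n))
    + (\<phi> l m * cnj (\<phi> l' m)) * (\<phi> k n * cnj (\<phi> k' n)))"
    by (intro sum.cong refl) (simp add: h_def sym_prod_def algebra_simps)
  also have "\<dots> = 2 * (S k k' * S l l' + S k l' * S l k')"
    by (simp only: sum.distrib sum_product [symmetric] S_def [symmetric]) (simp add: algebra_simps)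
  also have "\<dots> = 2 * (if (k, l) = (k', l') then diag_weight k l * N ^ 2 else 0)"
    using kl by (auto simp: S diag_weight_def mem_lower_triangle power2_eq_square)
  finally show ?thesis
    by (simp add: h_def)
qed

text \<open>Pairing the equations with \<open>cnj (E p q)\<close> isolates \<open>d p\<close> by
  \<open>orth\<close>; inserting the formula for d gives back f by \<open>dual\<close>. Having both
  relations avoids comparing the sizes of P and Q.\<close>

lemma biorthogonal_expansion_iff:
  fixes E :: "'p \<Rightarrow> 'q \<Rightarrow> complex"
  assumes fin: "finite P" "finite Q"
    and v: "\<And>p. p \<in> P \<Longrightarrow> v p \<noteq> 0" and u: "\<And>q. q \<in> Q \<Longrightarrow> u q \<noteq> 0"
    and orth: "\<And>p p'. p \<in> P \<Longrightarrow> p' \<in> P \<Longrightarrow>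
      (\<Sum>q\<in>Q. inverse (u q) * (E p q * cnj (E p' q))) = (if p = p' then v p * s else 0)"
    and dual: "\<And>q q'. q \<in> Q \<Longrightarrow> q' \<in> Q \<Longrightarrow>
      (\<Sum>p\<in>P. inverse (v p) * (E p q * cnj (E p q'))) = (if q = q' then u q * s else 0)"
    and s: "s \<noteq> 0"
  shows "(\<forall>q\<in>Q. (\<Sum>p\<in>P. d p * E p q) = f q) \<longleftrightarrow>
    (\<forall>p\<in>P. d p = 1 / (v p * s) * (\<Sum>q\<in>Q. inverse (u q) * f q * cnj (E p q)))"
    (is "?L \<longleftrightarrow> ?R")
proof
  assume L: ?L
  show ?R
  proof
    fix p assume p: "p \<in> P"
    have "(\<Sum>q\<in>Q. inverse (u q) * f q * cnj (E p q))
        = (\<Sum>q\<in>Q. \<Sum>p'\<in>P. d p' * (inverse (u q) * (E p' q * cnj (E p q))))"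
      by (intro sum.cong refl) (simp add: sum_distrib_left sum_distrib_right mult_ac flip: L)
    also have "\<dots> = (\<Sum>p'\<in>P. d p' * (\<Sum>q\<in>Q. inverse (u q) * (E p' q * cnj (E p q))))"
      by (subst sum.swap) (simp add: sum_distrib_left)
    also have "\<dots> = (\<Sum>p'\<in>P. if p' = p then d p * (v p * s) else 0)"
      by (rule sum.cong) (auto simp: orth p)
    also have "\<dots> = d p * (v p * s)"
      using p fin by simp
    finally show "d p = 1 / (v p * s) * (\<Sum>q\<in>Q. inverse (u q) * f q * cnj (E p q))"
      using v [OF p] s by simp
  qed
next
  assume R: ?R
  show ?L
  proof
    fix q assume q: "q \<in> Q"
    have "(\<Sum>p\<in>P. d p * E p q)
        = (\<Sum>p\<in>P. \<Sum>q'\<in>Q. inverse (u q') * f q' / s * (inverse (v p) * (E p q * cnj (E p q'))))"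
      using R by (intro sum.cong refl)
        (simp add: sum_distrib_left sum_distrib_right field_simps)
    also have "\<dots> = (\<Sum>q'\<in>Q. inverse (u q') * f q' / s *
        (\<Sum>p\<in>P. inverse (v p) * (E p q * cnj (E p q'))))"
      by (subst sum.swap) (simp add: sum_distrib_left)
    also have "\<dots> = (\<Sum>q'\<in>Q. if q' = q then f q else 0)"
      by (rule sum.cong) (use s u in \<open>auto simp: dual q\<close>)
    also have "\<dots> = f q"
      using q fin by simp
    finally show "(\<Sum>p\<in>P. d p * E p q) = f q" .
  qed
qed

section \<open>Exponentials on the grid\<close>

lemma sum_roots_of_unity:
  fixes q :: int
  assumes "N > 0"
  shows "(\<Sum>j<N. exp (2 * of_real pi * \<i> * of_real (real j * of_int q / real N)))
    = (if int N dvd q then of_nat N else 0)"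
proof -
  define w where "w = exp (2 * of_real pi * \<i> * of_real (of_int q / real N))"
  have w: "exp (2 * of_real pi * \<i> * of_real (real j * of_int q / real N)) = w ^ j" for j
    unfolding w_def exp_of_nat_mult [symmetric] by (simp add: mult_ac)
  have wN: "w ^ N = 1"
    unfolding w [symmetric] using assms by (simp add: exp_eq_1 flip: of_real_mult)
  have w1: "w = 1 \<longleftrightarrow> int N dvd q"
  proof -
    have "exp (2 * of_real pi * \<i> * of_real x) = 1 \<longleftrightarrow> (\<exists>n::int. x = of_int n)" for x
      by (simp add: exp_eq_1)
    then have "w = 1 \<longleftrightarrow> (\<exists>n::int. of_int q / real N = of_int n)"
      by (simp only: w_def)
    also have "\<dots> \<longleftrightarrow> (\<exists>n::int. real_of_int q = of_int (int N * n))"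
      using assms by (simp add: field_simps)
    also have "\<dots> \<longleftrightarrow> int N dvd q"
      unfolding of_int_eq_iff by (auto simp: dvd_def)
    finally show ?thesis .
  qed
  show ?thesis
    unfolding w using wN w1 by (auto simp: sum_gp_strict)
qed

definition grid_exp :: "real \<Rightarrow> real \<Rightarrow> nat \<Rightarrow> int \<Rightarrow> nat \<Rightarrow> complex" where
  "grid_exp a b N k m = exp (2 * of_real pi * \<i> * of_real (of_int k * grid_pt a b N m))"

lemma sym_exp_grid:
  "sym_exp k l (grid_pt a b N m) (grid_pt a b N n) = sym_prod (grid_exp a b N) k l m n"
  by (simp add: sym_exp_def sym_prod_def grid_exp_def ring_distribs exp_add)

lemma grid_exp_cnj:
  "grid_exp a b N k m * cnj (grid_exp a b N k' m')
   = exp (2 * of_real pi * \<i> * of_real (of_int k * grid_pt a b N m - of_int k' * grid_pt a b N m'))"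
  by (simp add: grid_exp_def exp_cnj algebra_simps flip: exp_add)

text \<open>The offset of the grid contributes only a phase independent of m, which leaves a sum of
  roots of unity.\<close>

lemma grid_exp_orthogonal:
  assumes "N > 0" "k \<in> {r..<r + int N}" "k' \<in> {r..<r + int N}"
  shows "(\<Sum>m<N. grid_exp a b N k m * cnj (grid_exp a b N k' m)) = (if k = k' then of_nat N else 0)"
proof -
  have "grid_exp a b N k m * cnj (grid_exp a b N k' m)
      = exp (2 * of_real pi * \<i> * of_real (of_int (k - k') * (a + b / real N)))
      * exp (2 * of_real pi * \<i> * of_real (real m * of_int (k - k') / real N))" for m
    unfolding grid_exp_cnj exp_add [symmetric] using assms(1)
    by (intro arg_cong [where f = exp]) (simp add: grid_pt_def field_simps)
  then have "(\<Sum>m<N. grid_exp a b N k m * cnj (grid_exp a b N k' m))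
      = exp (2 * of_real pi * \<i> * of_real (of_int (k - k') * (a + b / real N)))
      * (if int N dvd k - k' then of_nat N else 0)"
    using sum_roots_of_unity [OF assms(1), of "k - k'"] by (simp flip: sum_distrib_left)
  \<comment> \<open>Both frequencies lie in a window of length N, so their difference is smaller
    than N in absolute value.\<close>
  moreover have "int N dvd k - k' \<longleftrightarrow> k = k'"
    using assms zdvd_imp_le [of "int N" "k - k'"] zdvd_imp_le [of "int N" "k' - k"]
    by (cases k k' rule: linorder_cases) (auto simp: dvd_diff_commute)
  ultimately show ?thesis
    by auto
qed

text \<open>In the difference of two grid points the offset cancels, and the start r of the window
  contributes only a phase.\<close>

lemma grid_exp_dual_orthogonal:
  assumes "N > 0" "m < N" "m' < N"
  shows "(\<Sum>k\<in>{r..<r + int N}. grid_exp a b N k m * cnj (grid_exp a b N k m'))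
    = (if m = m' then of_nat N else 0)"
proof -
  define q where "q = int m - int m'"
  have "(\<Sum>k\<in>{r..<r + int N}. grid_exp a b N k m * cnj (grid_exp a b N k m'))
      = (\<Sum>j<N. grid_exp a b N (r + int j) m * cnj (grid_exp a b N (r + int j) m'))"
    by (rule sum.reindex_bij_witness [of _ "\<lambda>j. r + int j" "\<lambda>k. nat (k - r)"]) auto
  also have "\<dots> = (\<Sum>j<N. exp (2 * of_real pi * \<i> * of_real (of_int r * of_int q / real N))
      * exp (2 * of_real pi * \<i> * of_real (real j * of_int q / real N)))"
    unfolding grid_exp_cnj exp_add [symmetric] using assms(1)
    by (intro sum.cong refl arg_cong [where f = exp]) (simp add: grid_pt_def q_def field_simps)
  also have "\<dots> = exp (2 * of_real pi * \<i> * of_real (of_int r * of_int q / real N))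
      * (if int N dvd q then of_nat N else 0)"
    using sum_roots_of_unity [OF assms(1), of q] by (simp flip: sum_distrib_left)
  moreover have "int N dvd q \<longleftrightarrow> m = m'"
    unfolding q_def using assms zdvd_imp_le [of "int N" "int m - int m'"]
      zdvd_imp_le [of "int N" "int m' - int m"]
    by (cases m m' rule: linorder_cases) (auto simp: dvd_diff_commute)
  ultimately show ?thesis
    by (auto simp: q_def)
qed

section \<open>Interpolation with frequencies from a complete residue system\<close>

lemma grid_pairs_eq: "grid_pairs N = lower_triangle {..<N}"
  by (auto simp: grid_pairs_def mem_lower_triangle)

lemma Gw_eq: "Gw k l = diag_weight k l"
  by (simp add: Gw_def diag_weight_def)

lemma grid_transform_eq:
  "grid_transform a b N f k l = (\<Sum>(m, n)\<in>lower_triangle {..<N}. inverse (diag_weight m n)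
     * f (grid_pt a b N m, grid_pt a b N n) * cnj (sym_prod (grid_exp a b N) k l m n))"
  by (simp add: grid_transform_def grid_pairs_eq sym_exp_grid Gw_def diag_weight_def)

lemma interpolation_on_residues_iff:
  assumes N: "N > 0"
  shows "(\<forall>(m, n)\<in>grid_pairs N. (\<Sum>(k, l)\<in>lower_triangle {r..<r + int N}.
        d k l * sym_exp k l (grid_pt a b N m) (grid_pt a b N n)) = f (grid_pt a b N m, grid_pt a b N n))
    \<longleftrightarrow> (\<forall>(k, l)\<in>lower_triangle {r..<r + int N}.
        d k l = 1 / (Gw k l * of_nat N ^ 2) * grid_transform a b N f k l)"
proof -
  let ?P = "lower_triangle {r..<r + int N}" and ?Q = "lower_triangle {..<N}"
  let ?\<phi> = "grid_exp a b N"
  have orth: "(\<Sum>q\<in>?Q. inverse (case_prod diag_weight q) *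
      (case_prod (case_prod (sym_prod ?\<phi>) p) q * cnj (case_prod (case_prod (sym_prod ?\<phi>) p') q)))
    = (if p = p' then case_prod diag_weight p * of_nat N ^ 2 else 0)" if "p \<in> ?P" "p' \<in> ?P" for p p'
    using sym_prod_orthogonal [of "{..<N}" "{r..<r + int N}" ?\<phi> "of_nat N" "fst p" "snd p" "fst p'" "snd p'"]
      grid_exp_orthogonal [OF N] that
    by (simp add: case_prod_unfold)
  \<comment> \<open>The same orthogonality lemma for the transposed matrix: frequencies and grid
    indices exchange roles.\<close>
  have dual: "(\<Sum>p\<in>?P. inverse (case_prod diag_weight p) *
      (case_prod (case_prod (sym_prod ?\<phi>) p) q * cnj (case_prod (case_prod (sym_prod ?\<phi>) p) q')))
    = (if q = q' then case_prod diag_weight q * of_nat N ^ 2 else 0)" if "q \<in> ?Q" "q' \<in> ?Q" for q q'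
    using sym_prod_orthogonal [of "{r..<r + int N}" "{..<N}" "\<lambda>m k. ?\<phi> k m" "of_nat N"
        "fst q" "snd q" "fst q'" "snd q'"]
      grid_exp_dual_orthogonal [OF N] that
    by (simp add: case_prod_unfold sym_prod_transpose [of ?\<phi>])
  have "(\<forall>q\<in>?Q. (\<Sum>p\<in>?P. case_prod d p * case_prod (case_prod (sym_prod ?\<phi>) p) q)
        = f (map_prod (grid_pt a b N) (grid_pt a b N) q)) \<longleftrightarrow>
    (\<forall>p\<in>?P. case_prod d p = 1 / (case_prod diag_weight p * of_nat N ^ 2) *
      (\<Sum>q\<in>?Q. inverse (case_prod diag_weight q) * f (map_prod (grid_pt a b N) (grid_pt a b N) q)
        * cnj (case_prod (case_prod (sym_prod ?\<phi>) p) q)))"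
    by (rule biorthogonal_expansion_iff [OF _ _ _ _ orth dual]) (use N in auto)
  then show ?thesis
    by (simp add: grid_pairs_eq sym_exp_grid grid_transform_eq Gw_eq case_prod_unfold map_prod_def)
qed

section \<open>Folding the boundary frequencies\<close>

lemma tau_nonzero [simp]: "tau a b N \<noteq> 0"
  by (simp add: tau_def)

lemma cnj_tau: "cnj (tau a b N) = inverse (tau a b N)"
  by (simp add: tau_def exp_cnj exp_minus)

text \<open>N times the grid point is N a + b + m, and the integer m disappears in the exponential,
  so the factor is the same at all grid points.\<close>

lemma grid_exp_add_period:
  assumes "N > 0"
  shows "grid_exp a b N (k + int N) m = tau a b N * grid_exp a b N k m"
proof -
  have "grid_exp a b N (k + int N) m
      = exp (2 * of_real pi * \<i> * of_real (of_int k * grid_pt a b N m)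
          + 2 * of_real pi * \<i> * of_real (real N * a + b)
          + 2 * of_real pi * \<i> * of_nat m)"
    unfolding grid_exp_def using assms
    by (intro arg_cong [where f = exp]) (simp add: grid_pt_def field_simps)
  moreover have "exp (2 * of_real pi * \<i> * of_nat m) = 1"
    using exp_integer_2pi [of "of_nat m"] by (simp add: mult_ac)
  ultimately show ?thesis
    by (simp add: exp_add grid_exp_def tau_def mult_ac)
qed

lemma sym_exp_boundary:
  assumes "N > 0" "int N = 2 * M"
  shows "sym_exp M l (grid_pt a b N m) (grid_pt a b N n)
    = tau a b N * sym_exp l (- M) (grid_pt a b N m) (grid_pt a b N n)"
  using grid_exp_add_period [OF assms(1), of a b "- M"] assms(2)
  by (simp add: sym_exp_grid sym_prod_def algebra_simps)

text \<open>\<open>sym_exp_boundary\<close> is conjugated here; \<open>tau\<close> has modulus 1, so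
  its conjugate is its inverse and the factor changes sides.\<close>

lemma grid_transform_boundary:
  assumes "N > 0" "int N = 2 * M"
  shows "grid_transform a b N f l (- M) = tau a b N * grid_transform a b N f M l"
  unfolding grid_transform_def sum_distrib_left
  by (rule sum.cong) (auto simp: sym_exp_boundary [OF assms] cnj_tau field_simps)

text \<open>The total coefficient at (k, l) after each (l, -M) is moved to (M, l). The pair (-M, -M)
  first goes to (M, -M) and then to (M, M), which costs \<tau> twice.\<close>

definition folded :: "complex \<Rightarrow> int \<Rightarrow> (int \<Rightarrow> int \<Rightarrow> complex) \<Rightarrow> int \<Rightarrow> int \<Rightarrow> complex" where
  "folded \<tau> M c k l = c k l + (if k = M then c l (- M) / \<tau> else 0)
     + (if k = M \<and> l = M then c (- M) (- M) / \<tau> ^ 2 else 0)"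

lemma sym_poly_folded:
  assumes N: "N > 0" "int N = 2 * M"
  shows "sym_poly M c (grid_pt a b N m) (grid_pt a b N n)
    = (\<Sum>(k, l)\<in>lower_triangle {- M + 1..<- M + 1 + int N}.
        folded (tau a b N) M c k l * sym_exp k l (grid_pt a b N m) (grid_pt a b N n))"
proof -
  define \<tau> where "\<tau> = tau a b N"
  have [simp]: "\<tau> \<noteq> 0"
    by (simp add: \<tau>_def)
  define E where "E k l = sym_exp k l (grid_pt a b N m) (grid_pt a b N n)" for k l
  have E: "E l (- M) = E M l / \<tau>" for l
    using sym_exp_boundary [OF N] by (simp add: E_def \<tau>_def)
  let ?R = "{- M + 1..<- M + 1 + int N}"
  have M: "M > 0" and R: "?R = {- M + 1..M}"
    using N by auto
  \<comment> \<open>M is the largest residue in \<open>?R\<close>, so the whole row k = M lies in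
    the triangle.\<close>
  have row: "(\<Sum>(k, l)\<in>lower_triangle ?R. if k = M then g l else 0) = (\<Sum>l\<in>?R. g l)" for g :: "int \<Rightarrow> complex"
  proof -
    have "(\<Sum>l\<in>?R. g l) = (\<Sum>(k, l)\<in>Pair M ` ?R. g l)"
      by (subst sum.reindex) (auto simp: inj_on_def)
    also have "\<dots> = (\<Sum>(k, l)\<in>lower_triangle ?R. if k = M then g l else 0)"
      by (rule sum.mono_neutral_cong_left) (use M R in \<open>auto simp: mem_lower_triangle\<close>)
    finally show ?thesis ..
  qed
  have "freq_pairs M = lower_triangle ?R \<union> (\<lambda>l. (l, - M)) ` {- M..M}"
    using R M by (auto simp: freq_pairs_def mem_lower_triangle image_iff)
  then have "(\<Sum>(k, l)\<in>freq_pairs M. c k l * E k l)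
      = (\<Sum>(k, l)\<in>lower_triangle ?R. c k l * E k l)
      + (\<Sum>(k, l)\<in>(\<lambda>l. (l, - M)) ` {- M..M}. c k l * E k l)"
    using R by (simp only:) (rule sum.union_disjoint, auto simp: mem_lower_triangle)
  also have "(\<Sum>(k, l)\<in>(\<lambda>l. (l, - M)) ` {- M..M}. c k l * E k l)
      = (\<Sum>l\<in>{- M..M}. c l (- M) * E l (- M))"
    by (subst sum.reindex) (auto simp: inj_on_def)
  \<comment> \<open>The index -M is split off because (M, -M) is still outside the residue triangle
    and has to be folded again.\<close>
  also have "{- M..M} = insert (- M) ?R"
    using R M by auto
  also have "(\<Sum>l\<in>\<dots>. c l (- M) * E l (- M))
      = (\<Sum>l\<in>?R. c l (- M) / \<tau> * E M l) + c (- M) (- M) / \<tau> ^ 2 * E M M"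
    using E [of "- M"] E [of M] by (subst sum.insert) (auto simp: E power2_eq_square)
  also have "c (- M) (- M) / \<tau> ^ 2 * E M M
      = (\<Sum>l\<in>?R. if l = M then c (- M) (- M) / \<tau> ^ 2 * E M M else 0)"
    using R M by (subst sum.delta) auto
  also have "(\<Sum>l\<in>?R. c l (- M) / \<tau> * E M l) = (\<Sum>(k, l)\<in>lower_triangle ?R. if k = M then c l (- M) / \<tau> * E M l else 0)"
    by (rule row [symmetric])
  also have "(\<Sum>l\<in>?R. if l = M then c (- M) (- M) / \<tau> ^ 2 * E M M else 0)
      = (\<Sum>(k, l)\<in>lower_triangle ?R. if k = M then if l = M then c (- M) (- M) / \<tau> ^ 2 * E M M else 0 else 0)"
    by (rule row [symmetric])
  also have "(\<Sum>(k, l)\<in>lower_triangle ?R. c k l * E k l) + (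
      (\<Sum>(k, l)\<in>lower_triangle ?R. if k = M then c l (- M) / \<tau> * E M l else 0) +
      (\<Sum>(k, l)\<in>lower_triangle ?R. if k = M then if l = M then c (- M) (- M) / \<tau> ^ 2 * E M M else 0 else 0))
    = (\<Sum>(k, l)\<in>lower_triangle ?R. folded \<tau> M c k l * E k l)"
    unfolding sum.distrib [symmetric]
    by (rule sum.cong) (auto simp: folded_def algebra_simps)
  finally show ?thesis
    by (simp add: sym_poly_def E_def \<tau>_def)
qed

text \<open>The parameter \<open>t\<close> covers both variants at once: \<open>t = 1\<close> gives \<^const>\<open>boundary_conds\<close>
  and \<open>t = 2\<close> gives \<^const>\<open>weighted_boundary_conds\<close>.\<close>

definition corner_conds ::
    "complex \<Rightarrow> complex \<Rightarrow> int \<Rightarrow> (int \<Rightarrow> int \<Rightarrow> complex) \<Rightarrow> bool" where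
  "corner_conds t \<tau> M c \<longleftrightarrow> (\<forall>l\<in>{- M..M}.
     (if l = - M then t else 1) * c l (- M) = \<tau> * ((if l = M then t else 1) * c M l))"

text \<open>At (M, M) the folded multiplicity 2 + t meets the weight \<open>Gw M M\<close> = 2.
  After the powers of \<tau> are removed, (-M, -M) has the same factor and (M, -M) has t times
  it.\<close>

definition corner_factor :: "complex \<Rightarrow> int \<Rightarrow> int \<Rightarrow> int \<Rightarrow> complex" where
  "corner_factor t M k l = (if \<bar>k\<bar> = M \<and> \<bar>l\<bar> = M then (if k = l then 1 else t) / (2 * (2 + t))
     else gw k M * gw l M / Gw k l)"

text \<open>The conditions at l = M and l = -M are chained; t cancels in the second corner.\<close>

lemma corner_conds_corners:
  assumes "corner_conds t \<tau> M c" "M > 0" "t \<noteq> 0"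
  shows "c M (- M) = t * \<tau> * c M M" "c (- M) (- M) = \<tau> ^ 2 * c M M"
proof -
  show *: "c M (- M) = t * \<tau> * c M M"
    using bspec [OF assms(1) [unfolded corner_conds_def], of M] assms(2) by simp
  have "t * c (- M) (- M) = \<tau> * c M (- M)"
    using bspec [OF assms(1) [unfolded corner_conds_def], of "- M"] assms(2) by simp
  then show "c (- M) (- M) = \<tau> ^ 2 * c M M"
    using assms(3) by (simp add: * power2_eq_square)
qed

text \<open>This extends agreement on the residue triangle to all of
  \<open>freq_pairs M\<close>.\<close>

lemma corner_conds_determined:
  assumes c: "corner_conds t \<tau> M c" and d: "corner_conds t \<tau> M d" and "M > 0" "t \<noteq> 0"
    and eq: "\<And>l. l \<in> {- M + 1..M} \<Longrightarrow> c M l = d M l"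
    and l: "l \<in> {- M..M}"
  shows "c l (- M) = d l (- M)"
proof -
  have M: "c M M = d M M"
    using eq \<open>M > 0\<close> by simp
  consider "l = - M" | "l = M" | "l \<in> {- M<..<M}"
    using l by force
  then show ?thesis
  proof cases
    case 1
    then show ?thesis
      using corner_conds_corners(2) [OF c assms(3,4)] corner_conds_corners(2) [OF d assms(3,4)] M
      by simp
  next
    case 2
    then show ?thesis
      using corner_conds_corners(1) [OF c assms(3,4)] corner_conds_corners(1) [OF d assms(3,4)] M
      by simp
  next
    case 3
    then show ?thesis
      using bspec [OF c [unfolded corner_conds_def] l] bspec [OF d [unfolded corner_conds_def] l]
        eq [of l] by simp
  qed
qed

text \<open>The transforms already carry the factor \<open>tau\<close>. For \<bar>l\<bar> < M both
  sides have the same \<open>corner_factor\<close>, and at the corners its ratio t is exactly what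
  the conditions ask for.\<close>

lemma corner_conds_transform:
  assumes N: "N > 0" "int N = 2 * M"
  shows "corner_conds t (tau a b N) M (\<lambda>k l. corner_factor t M k l * s * grid_transform a b N f k l)"
proof -
  have "M > 0"
    using N by auto
  then show ?thesis
    unfolding corner_conds_def using grid_transform_boundary [OF N]
    by (auto simp: corner_factor_def Gw_def gw_def)
qed

lemma even_interpolation_iff:
  assumes N: "N > 0" "int N = 2 * M" and t: "t \<noteq> 0" "2 + t \<noteq> 0"
    and c: "corner_conds t (tau a b N) M c"
  shows "interpolates a b N f (sym_poly M c) \<longleftrightarrow> (\<forall>(k, l)\<in>freq_pairs M.
    c k l = corner_factor t M k l * (1 / of_nat N ^ 2) * grid_transform a b N f k l)"
    (is "_ \<longleftrightarrow> (\<forall>(k, l)\<in>_. c k l = ?C k l)")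
proof -
  define \<tau> where "\<tau> = tau a b N"
  have \<tau> [simp]: "\<tau> \<noteq> 0"
    by (simp add: \<tau>_def)
  have M: "M > 0"
    using N by auto
  have C: "corner_conds t \<tau> M ?C"
    unfolding \<tau>_def by (rule corner_conds_transform [OF N])
  note c = c [folded \<tau>_def]
  let ?R = "{- M + 1..<- M + 1 + int N}"
  have R: "?R = {- M + 1..M}"
    using N by auto
  \<comment> \<open>At (M, M) the corners (M, M), (M, -M) and (-M, -M) contribute 1, t and 1;
    elsewhere in the row k = M two equal terms meet.\<close>
  define \<rho> where "\<rho> k l = (if k = M then if l = M then 2 + t else 2 else 1)" for k l
  have \<rho>: "\<rho> k l \<noteq> 0" for k l
    using t by (simp add: \<rho>_def)
  have folded: "folded \<tau> M d k l = \<rho> k l * d k l"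
    if d: "corner_conds t \<tau> M d" and kl: "(k, l) \<in> lower_triangle ?R" for d k l
  proof -
    have "d l (- M) = \<tau> * d M l" if "l \<in> {- M<..<M}" for l
      using bspec [OF d [unfolded corner_conds_def], of l] that by simp
    then show ?thesis
      using kl corner_conds_corners [OF d M t(1)] unfolding R
      by (auto simp: folded_def \<rho>_def mem_lower_triangle algebra_simps)
  qed
  have CR: "\<rho> k l * ?C k l = 1 / (Gw k l * of_nat N ^ 2) * grid_transform a b N f k l"
    if "(k, l) \<in> lower_triangle ?R" for k l
    using that M t(2) unfolding R
    by (auto simp: \<rho>_def corner_factor_def mem_lower_triangle gw_def Gw_def simp del: distrib_left_numeral)
  have coeff_iff: "folded \<tau> M c k l = 1 / (Gw k l * of_nat N ^ 2) * grid_transform a b N f k l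
      \<longleftrightarrow> c k l = ?C k l" if "(k, l) \<in> lower_triangle ?R" for k l
    unfolding CR [OF that, symmetric] folded [OF c that] by (rule mult_left_cancel [OF \<rho>])
  have "interpolates a b N f (sym_poly M c) \<longleftrightarrow> (\<forall>(k, l)\<in>lower_triangle ?R. folded \<tau> M c k l
      = 1 / (Gw k l * of_nat N ^ 2) * grid_transform a b N f k l)"
    unfolding interpolates_def sym_poly_folded [OF N] \<tau>_def
    by (rule interpolation_on_residues_iff [OF N(1)])
  also have "\<dots> \<longleftrightarrow> (\<forall>(k, l)\<in>lower_triangle ?R. c k l = ?C k l)"
    by (rule ball_cong [OF refl]) (use coeff_iff in blast)
  also have "\<dots> \<longleftrightarrow> (\<forall>(k, l)\<in>freq_pairs M. c k l = ?C k l)"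
  proof
    assume *: "\<forall>(k, l)\<in>lower_triangle ?R. c k l = ?C k l"
    \<comment> \<open>Row M of the residue triangle is all that is needed to recover the removed
      terms (l, -M).\<close>
    have M': "c M l = ?C M l" if "l \<in> {- M + 1..M}" for l
      using * that M unfolding R by (auto simp: mem_lower_triangle)
    have "c l (- M) = ?C l (- M)" if "l \<in> {- M..M}" for l
      using M' that by (rule corner_conds_determined [OF c C M t(1)])
    moreover have "(k, l) \<in> lower_triangle ?R \<or> l = - M \<and> k \<in> {- M..M}" if "(k, l) \<in> freq_pairs M" for k l
      using that unfolding R by (auto simp: mem_lower_triangle freq_pairs_def)
    ultimately show "\<forall>(k, l)\<in>freq_pairs M. c k l = ?C k l"
      using * by blast
  next
    assume "\<forall>(k, l)\<in>freq_pairs M. c k l = ?C k l"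
    then show "\<forall>(k, l)\<in>lower_triangle ?R. c k l = ?C k l"
      unfolding R by (auto simp: mem_lower_triangle freq_pairs_def)
  qed
  finally show ?thesis .
qed

section \<open>Existence, uniqueness and the coefficient formulas\<close>

lemma unique_interpolation:
  assumes "\<And>c. B c \<Longrightarrow> interpolates a b N f (sym_poly M c) \<longleftrightarrow> (\<forall>(k, l)\<in>freq_pairs M. c k l = C k l)"
    and "B C"
  shows "(\<exists>!\<psi>. \<exists>c. \<psi> = sym_poly M c \<and> B c \<and> interpolates a b N f \<psi>) \<and>
    (\<forall>c. B c \<and> interpolates a b N f (sym_poly M c) \<longrightarrow> (\<forall>(k, l)\<in>freq_pairs M. c k l = C k l))"
proof -
  \<comment> \<open>Uniqueness concerns the function, which depends on c only through
    \<open>freq_pairs M\<close>; existence is witnessed by C itself.\<close>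
  have "sym_poly M c = sym_poly M C" if "\<forall>(k, l)\<in>freq_pairs M. c k l = C k l" for c
    unfolding sym_poly_def by (intro ext sum.cong refl) (use that in auto)
  moreover have "interpolates a b N f (sym_poly M C)"
    using assms by auto
  ultimately show ?thesis
    using assms by (intro conjI ex1I [of _ "sym_poly M C"]) metis+
qed

theorem proposition3p2:
  fixes a b :: real and N :: nat and M :: int and f :: "real \<times> real \<Rightarrow> complex"
  assumes "b \<in> {0..1}" and "N > 0"
    and "f \<in> sym_triangle a \<rightarrow>\<^sub>E (UNIV :: complex set)"
  shows
    "(int N = 2 * M + 1 \<longrightarrow>
        (\<exists>!\<psi>. \<exists>c. \<psi> = sym_poly M c \<and> interpolates a b N f \<psi>) \<and>
        (\<forall>c. interpolates a b N f (sym_poly M c) \<longrightarrow>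
          (\<forall>(k, l)\<in>freq_pairs M.
             c k l = 1 / (Gw k l * of_nat N ^ 2) * grid_transform a b N f k l))) \<and>
     (int N = 2 * M \<longrightarrow>
        (\<exists>!\<psi>. \<exists>c. \<psi> = sym_poly M c \<and> boundary_conds a b N M c \<and> interpolates a b N f \<psi>) \<and>
        (\<forall>c. boundary_conds a b N M c \<and> interpolates a b N f (sym_poly M c) \<longrightarrow>
          (\<forall>(k, l)\<in>freq_pairs M.
             c k l = (if \<bar>k\<bar> = M \<and> \<bar>l\<bar> = M then 1 / (6 * of_nat N ^ 2)
                      else gw k M * gw l M / (Gw k l * of_nat N ^ 2))
                     * grid_transform a b N f k l))) \<and>
     (int N = 2 * M \<longrightarrow>
        (\<exists>!\<psi>. \<exists>c. \<psi> = sym_poly M c \<and> weighted_boundary_conds a b N M c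
                 \<and> interpolates a b N f \<psi>) \<and>
        (\<forall>c. weighted_boundary_conds a b N M c \<and> interpolates a b N f (sym_poly M c) \<longrightarrow>
          (\<forall>(k, l)\<in>freq_pairs M.
             c k l = gw k M * gw l M / (Gw k l * of_nat N ^ 2) * grid_transform a b N f k l)))"
proof (intro conjI[of "_ \<longrightarrow> _"] impI)
  assume odd: "int N = 2 * M + 1"
  \<comment> \<open>For odd N the frequencies -M, ..., M already form a complete residue system, so
    nothing is folded.\<close>
  have tri: "freq_pairs M = lower_triangle {- M..<- M + int N}"
    using odd by (auto simp: freq_pairs_def mem_lower_triangle)
  have "interpolates a b N f (sym_poly M c) \<longleftrightarrow> (\<forall>(k, l)\<in>freq_pairs M.
      c k l = 1 / (Gw k l * of_nat N ^ 2) * grid_transform a b N f k l)" for c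
    unfolding interpolates_def sym_poly_def tri
    by (rule interpolation_on_residues_iff [OF \<open>N > 0\<close>])
  from unique_interpolation [where B = "\<lambda>_. True", OF this]
  show "(\<exists>!\<psi>. \<exists>c. \<psi> = sym_poly M c \<and> interpolates a b N f \<psi>) \<and>
        (\<forall>c. interpolates a b N f (sym_poly M c) \<longrightarrow>
          (\<forall>(k, l)\<in>freq_pairs M.
             c k l = 1 / (Gw k l * of_nat N ^ 2) * grid_transform a b N f k l))"
    by simp
next
  assume even: "int N = 2 * M"
  have B: "boundary_conds a b N M c \<longleftrightarrow> corner_conds 1 (tau a b N) M c" for c
    by (simp add: boundary_conds_def corner_conds_def)
  \<comment> \<open>For t = 1 both corner values are 1 / (2 * 3).\<close>
  have C: "corner_factor 1 M k l * (1 / of_nat N ^ 2) = (if \<bar>k\<bar> = M \<and> \<bar>l\<bar> = M then 1 / (6 * of_nat N ^ 2)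
      else gw k M * gw l M / (Gw k l * of_nat N ^ 2))" for k l
    by (simp add: corner_factor_def)
  show "(\<exists>!\<psi>. \<exists>c. \<psi> = sym_poly M c \<and> boundary_conds a b N M c \<and> interpolates a b N f \<psi>) \<and>
        (\<forall>c. boundary_conds a b N M c \<and> interpolates a b N f (sym_poly M c) \<longrightarrow>
          (\<forall>(k, l)\<in>freq_pairs M.
             c k l = (if \<bar>k\<bar> = M \<and> \<bar>l\<bar> = M then 1 / (6 * of_nat N ^ 2)
                      else gw k M * gw l M / (Gw k l * of_nat N ^ 2))
                     * grid_transform a b N f k l))"
    unfolding B C [symmetric]
    by (intro unique_interpolation even_interpolation_iff corner_conds_transform)
      (use \<open>N > 0\<close> even in auto)
next
  assume even: "int N = 2 * M"
  then have M: "M > 0"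
    using \<open>N > 0\<close> by auto
  \<comment> \<open>\<open>Gw l (-M)\<close> is 2 only at l = -M and \<open>Gw M l\<close> only at l
    = M, which is t = 2.\<close>
  have B: "weighted_boundary_conds a b N M c \<longleftrightarrow> corner_conds 2 (tau a b N) M c" for c
    unfolding weighted_boundary_conds_def corner_conds_def Gw_def
    by (intro ball_cong) auto
  \<comment> \<open>For t = 2 the corner values 1/8 (k = l) and 1/4 (otherwise) agree with the
    general formula, so no case distinction remains.\<close>
  have C: "corner_factor 2 M k l * (1 / of_nat N ^ 2) = gw k M * gw l M / (Gw k l * of_nat N ^ 2)" for k l
    using M by (auto simp: corner_factor_def gw_def Gw_def)
  show "(\<exists>!\<psi>. \<exists>c. \<psi> = sym_poly M c \<and> weighted_boundary_conds a b N M c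
                 \<and> interpolates a b N f \<psi>) \<and>
        (\<forall>c. weighted_boundary_conds a b N M c \<and> interpolates a b N f (sym_poly M c) \<longrightarrow>
          (\<forall>(k, l)\<in>freq_pairs M.
             c k l = gw k M * gw l M / (Gw k l * of_nat N ^ 2) * grid_transform a b N f k l))"
    unfolding B C [symmetric]
    by (intro unique_interpolation even_interpolation_iff corner_conds_transform)
      (use \<open>N > 0\<close> even in auto)
qed

end
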